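(* Let $G$ be a bush graph with exactly two distinct edge weights (and an arbitrary number of edges in each bush). Then the expected weight of the greedy matching returned by the algorithm \textsc{Rgma} on $G$ is at least $\frac{2}{3}\,\mathrm{OPT}(G)$.
   Context: Graphs are finite, simple, undirected, with positive edge weights; the weight of a matching is the sum of its edge weights. With distinct edge weights $w_1>\dots>w_\ell$, a greedy matching is any matching that can be output by: $\mathcal{M}\leftarrow\emptyset$; for $i=1,\dots,\ell$, while the current edge set contains an edge of weight $w_i$, pick any such edge $e^*$, add it to $\mathcal{M}$ and delete all edges sharing an endpoint with $e^*$. $\mathrm{OPT}(G)$ is the maximum weight of a greedy matching of $G$. $G$ is a bush graph if for every $i$ the edges of weight $w_i$ form a star (all share a common vertex, the center); this star is the $i$-th bush. Algorithm \textsc{Rgma} on a bush graph: $\mathcal{M}\leftarrow\emptyset$; for $i=1,\dots,\ell$: let $G_i$ be the set of edges of weight $w_i$ still present in the current graph; if $G_i\neq\emptyset$, select an edge $e_i\in G_i$ uniformly at random, add it to $\mathcal{M}$, and delete from the current graph both endpoints of $e_i$ (with their incident edges) and all edges of $G_i$. Output $\mathcal{M}$. *)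

theory Defs
  imports "HOL-Probability.Probability"
begin

text \<open>
  A simple undirected graph is a vertex set together with a set of two-element sets of
  vertices. The weight function \<open>w\<close> is only relevant on the edge set.
\<close>

definition weighted_graph :: "'a set \<Rightarrow> 'a set set \<Rightarrow> ('a set \<Rightarrow> real) \<Rightarrow> bool" where
  "weighted_graph V E w \<longleftrightarrow>
     finite V \<and> (\<forall>e\<in>E. e \<subseteq> V \<and> card e = 2) \<and> (\<forall>e\<in>E. 0 < w e)"

definition edge_weights :: "'a set set \<Rightarrow> ('a set \<Rightarrow> real) \<Rightarrow> real list" where
  "edge_weights E w = rev (sorted_list_of_set (w ` E))"

definition matching_weight :: "('a set \<Rightarrow> real) \<Rightarrow> 'a set set \<Rightarrow> real" where
  "matching_weight w M = (\<Sum>e\<in>M. w e)"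

text \<open>
  \<open>greedy_run w ws C M M'\<close>: with the weights \<open>ws\<close> still to be processed (the head being the
  current one), current edge set \<open>C\<close> and current matching \<open>M\<close>, the greedy algorithm can
  output \<open>M'\<close>. The chosen edge meets itself, so it is deleted as well.
\<close>

inductive greedy_run ::
    "('a set \<Rightarrow> real) \<Rightarrow> real list \<Rightarrow> 'a set set \<Rightarrow> 'a set set \<Rightarrow> 'a set set \<Rightarrow> bool"
  for w :: "'a set \<Rightarrow> real" where
  finish: "greedy_run w [] C M M"
| pick: "greedy_run w (x # xs) C M M'"
    if "e \<in> C" "w e = x" "greedy_run w (x # xs) {f \<in> C. f \<inter> e = {}} (insert e M) M'"
| skip: "greedy_run w (x # xs) C M M'"
    if "\<forall>e\<in>C. w e \<noteq> x" "greedy_run w xs C M M'"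

definition greedy_matching :: "'a set set \<Rightarrow> ('a set \<Rightarrow> real) \<Rightarrow> 'a set set \<Rightarrow> bool" where
  "greedy_matching E w M \<longleftrightarrow> greedy_run w (edge_weights E w) E {} M"

definition OPT :: "'a set set \<Rightarrow> ('a set \<Rightarrow> real) \<Rightarrow> real" where
  "OPT E w = Max (matching_weight w ` {M. greedy_matching E w M})"

definition bush_graph :: "'a set set \<Rightarrow> ('a set \<Rightarrow> real) \<Rightarrow> bool" where
  "bush_graph E w \<longleftrightarrow> (\<forall>x \<in> w ` E. \<exists>c. \<forall>e\<in>E. w e = x \<longrightarrow> c \<in> e)"

text \<open>
  The arguments are those of \<open>greedy_run\<close>. Deleting the two endpoints of the selected edge
  amounts to keeping only the edges disjoint from it, so vertices need not be tracked.
\<close>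

fun rgma_run ::
    "('a set \<Rightarrow> real) \<Rightarrow> real list \<Rightarrow> 'a set set \<Rightarrow> 'a set set \<Rightarrow> 'a set set pmf" where
  "rgma_run w [] C M = return_pmf M"
| "rgma_run w (x # xs) C M =
     (let G = {e \<in> C. w e = x} in
      if G = {} then rgma_run w xs C M
      else do {
        e \<leftarrow> pmf_of_set G;
        rgma_run w xs ({f \<in> C. f \<inter> e = {}} - G) (insert e M)
      })"

definition rgma :: "'a set set \<Rightarrow> ('a set \<Rightarrow> real) \<Rightarrow> 'a set set pmf" where
  "rgma E w = rgma_run w (edge_weights E w) E {}"

lemma greedy_run_subset: "greedy_run w ws C M M' \<Longrightarrow> M' \<subseteq> M \<union> C"
proof (induction rule: greedy_run.induct)
  case (finish M)
  show ?case by blast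
next
  case (pick e C x xs M M')
  then show ?case by blast
next
  case (skip C x xs M M')
  then show ?case by blast
qed

lemma greedy_run_exists:
  assumes "finite C" and "{} \<notin> C"
  shows "\<exists>M'. greedy_run w ws C M M'"
  using assms
proof (induction ws arbitrary: C M)
  case Nil
  show ?case using greedy_run.finish by blast
next
  case (Cons x xs)
  note IH = Cons.IH
  show ?case
    using Cons.prems
  proof (induction C arbitrary: M rule: finite_psubset_induct)
    case (psubset C)
    show ?case
    proof (cases "\<exists>e\<in>C. w e = x")
      case True
      then obtain e where e: "e \<in> C" "w e = x" by blast
      have "e \<noteq> {}" using e psubset.prems by blast
      then have "{f \<in> C. f \<inter> e = {}} \<subset> C" using e by blast
      moreover have "{} \<notin> {f \<in> C. f \<inter> e = {}}" using psubset.prems by blast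
      ultimately obtain M' where "greedy_run w (x # xs) {f \<in> C. f \<inter> e = {}} (insert e M) M'"
        using psubset.IH by meson
      then have "greedy_run w (x # xs) C M M'" by (rule greedy_run.pick[of e C w x, OF e])
      then show ?thesis ..
    next
      case False
      then have no: "\<forall>e\<in>C. w e \<noteq> x" by blast
      obtain M' where "greedy_run w xs C M M'"
        using IH[OF psubset.hyps psubset.prems] by blast
      then have "greedy_run w (x # xs) C M M'" by (rule greedy_run.skip[of C w x, OF no])
      then show ?thesis ..
    qed
  qed
qed

text \<open>The maximum in the definition of \<open>OPT\<close> is over a finite nonempty set.\<close>

lemma greedy_matchings_finite_nonempty:
  assumes "weighted_graph V E w"
  shows "finite {M. greedy_matching E w M}" and "{M. greedy_matching E w M} \<noteq> {}"
proof -
  have "E \<subseteq> Pow V" "finite (Pow V)"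
    using assms unfolding weighted_graph_def by blast+
  then have fin: "finite E" by (rule finite_subset)
  have ne: "{} \<notin> E" using assms unfolding weighted_graph_def by fastforce
  have "{M. greedy_matching E w M} \<subseteq> Pow E"
  proof
    fix M
    assume "M \<in> {M. greedy_matching E w M}"
    then have "greedy_run w (edge_weights E w) E {} M" by (simp add: greedy_matching_def)
    from greedy_run_subset[OF this] show "M \<in> Pow E" by simp
  qed
  moreover have "finite (Pow E)" using fin by simp
  ultimately show "finite {M. greedy_matching E w M}" by (rule finite_subset)
  obtain M where "greedy_run w (edge_weights E w) E {} M"
    using greedy_run_exists[OF fin ne] by blast
  then show "{M. greedy_matching E w M} \<noteq> {}" unfolding greedy_matching_def by blast
qed

end

theory Submission
  imports Defs
begin

text \<open>
  Let \<open>a > b\<close> be the two weights. \<open>Rgma\<close> earns \<open>a + b p\<close> in expectation, where \<open>p\<close> is the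
  fraction of edges of the first bush that leave some edge of the second bush intact. An edge
  of the first bush that destroys the whole second bush must meet each of its edges; so, unless
  all edges of the first bush are destructive (and then \<open>OPT = a\<close>), at most two of them are. Hence
  \<open>p = 0\<close> and \<open>OPT = a\<close>, or \<open>p \<ge> 1/3\<close> and \<open>a + b p \<ge> 2/3 (a + b)\<close> because \<open>a > b\<close>.
\<close>

lemma card_two_set_containing:
  assumes "card e = 2" "c \<in> e" "y \<in> e" "y \<noteq> c"
  shows "e = {c, y}"
proof -
  have "{c, y} \<subseteq> e" "card {c, y} = card e" "finite e"
    using assms by (auto intro: card_ge_0_finite)
  then show ?thesis by (metis card_subset_eq)
qed

text \<open>If \<open>c\<close> lies on every edge of \<open>B\<close>, then every edge of
  \<open>A\<close> meets all of \<open>B\<close> in \<open>c\<close>. Otherwise some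
  \<open>{d, y}\<close> in \<open>B\<close> misses \<open>c\<close>, and an edge through
  \<open>c\<close> can meet it only by being \<open>{c, d}\<close> or \<open>{c, y}\<close>.\<close>

lemma star_transversals:
  assumes A: "\<And>e. e \<in> A \<Longrightarrow> card e = 2 \<and> c \<in> e"
    and B: "\<And>f. f \<in> B \<Longrightarrow> card f = 2"
  shows "{e \<in> A. \<forall>f\<in>B. f \<inter> e \<noteq> {}} = A \<or> card {e \<in> A. \<forall>f\<in>B. f \<inter> e \<noteq> {}} \<le> 2"
proof (cases "\<forall>f\<in>B. c \<in> f")
  case True
  then show ?thesis using A by blast
next
  case False
  then obtain f where f: "f \<in> B" "c \<notin> f" by blast
  then obtain d y where dy: "f = {d, y}" using B card_2_iff by metis
  have "{e \<in> A. \<forall>f\<in>B. f \<inter> e \<noteq> {}} \<subseteq> {{c, d}, {c, y}}"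
  proof
    fix e assume e: "e \<in> {e \<in> A. \<forall>f\<in>B. f \<inter> e \<noteq> {}}"
    then obtain z where "z \<in> e" "z \<in> {d, y}" using f dy by blast
    moreover have "e = {c, z}"
      using card_two_set_containing[of e c z] A e f dy calculation by blast
    ultimately show "e \<in> {{c, d}, {c, y}}" by blast
  qed
  then have "card {e \<in> A. \<forall>f\<in>B. f \<inter> e \<noteq> {}} \<le> card {{c, d}, {c, y}}"
    by (intro card_mono) auto
  also have "\<dots> \<le> 2" by (simp add: card_insert_if)
  finally show ?thesis ..
qed

text \<open>Picking an edge keeps the current weight, so a run may pick repeatedly in one weight
  class. When the edges of that class pairwise meet, the first pick deletes all the others and the
  next step must be a skip.\<close>

lemma greedy_run_star_cases [consumes 1, case_names star no_edge edge]:
  assumes "greedy_run w (x # xs) C M M'"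
    and "\<And>e f. e \<in> C \<Longrightarrow> f \<in> C \<Longrightarrow> w e = x \<Longrightarrow> w f = x \<Longrightarrow> f \<inter> e \<noteq> {}"
  obtains "\<forall>e\<in>C. w e \<noteq> x" "greedy_run w xs C M M'"
  | e where "e \<in> C" "w e = x"
      "greedy_run w xs {f \<in> C. f \<inter> e = {}} (insert e M) M'"
  using assms(1)
proof cases
  case (pick e)
  from pick(3) show thesis
  proof cases
    case (pick e')
    then show thesis using assms(2) \<open>e \<in> C\<close> \<open>w e = x\<close> by blast
  next
    case skip
    then show thesis using that(2) pick by blast
  qed
next
  case skip
  then show thesis using that(1) by blast
qed

lemma edge_weights_two:
  assumes "card (w ` E) = 2"
  obtains a b where "b < a" "w ` E = {a, b}" "edge_weights E w = [a, b]"
proof -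
  obtain s t where "w ` E = {s, t}" "s \<noteq> t" using assms card_2_iff by metis
  then obtain a b where ab: "b < a" "w ` E = {a, b}"
    by (metis insert_commute linorder_neqE)
  then have "edge_weights E w = [a, b]"
    by (simp add: edge_weights_def insort_is_Cons)
  with ab show thesis using that by blast
qed

theorem theorem8:
  fixes V :: "'a set" and E :: "'a set set" and w :: "'a set \<Rightarrow> real"
  assumes "weighted_graph V E w"
    and "bush_graph E w"
    and "card (w ` E) = 2"
  shows "measure_pmf.expectation (rgma E w) (matching_weight w) \<ge> 2 / 3 * OPT E w"
proof -
  obtain a b where ab: "b < a" and img: "w ` E = {a, b}"
    and ew: "edge_weights E w = [a, b]"
    using edge_weights_two[OF assms(3)] .
  have graph: "finite V" "\<And>e. e \<in> E \<Longrightarrow> e \<subseteq> V \<and> card e = 2" "\<And>e. e \<in> E \<Longrightarrow> 0 < w e"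
    using assms(1) unfolding weighted_graph_def by auto
  have "b \<in> w ` E" using img by simp
  then have b0: "0 < b" using graph(3) by auto
  have "E \<subseteq> Pow V" using graph(2) by blast
  then have finE: "finite E" using graph(1) by (simp add: finite_subset)
  obtain c d where c: "\<And>e. e \<in> E \<Longrightarrow> w e = a \<Longrightarrow> c \<in> e"
    and d: "\<And>e. e \<in> E \<Longrightarrow> w e = b \<Longrightarrow> d \<in> e"
    using assms(2) img unfolding bush_graph_def by (metis insertCI)
  define A where "A = {e \<in> E. w e = a}"
  define B where "B = {e \<in> E. w e = b}"
  \<comment> \<open>\<open>K\<close> collects the first choices that destroy the whole second bush;
    \<open>g e\<close> is the final weight once \<open>e\<close> is chosen first.\<close>
  define K where "K = {e \<in> A. \<forall>f\<in>B. f \<inter> e \<noteq> {}}"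
  define g where "g e = a + (if e \<in> K then 0 else b)" for e
  have "a \<in> w ` E" using img by simp
  then have A: "finite A" "A \<noteq> {}" using finE unfolding A_def by auto
  have K: "K = A \<or> card K \<le> 2"
    unfolding K_def by (rule star_transversals[where c = c]) (auto simp: A_def B_def graph c)
  have KA: "K \<subseteq> A" by (auto simp: K_def)
  have pair: "matching_weight w (insert f {e}) = a + b" if "e \<in> A" "f \<in> B" for e f
  proof -
    have "f \<noteq> e" using that ab by (auto simp: A_def B_def)
    then show ?thesis using that by (simp add: matching_weight_def A_def B_def)
  qed
  have single: "matching_weight w {e} = a" if "e \<in> A" for e
    using that by (simp add: matching_weight_def A_def)

  \<comment> \<open>After the first choice the weight is no longer random: the edges of
    \<open>B\<close> all weigh \<open>b\<close>, so it matters only whether one of them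
    survives.\<close>
  have second: "map_pmf (matching_weight w) (rgma_run w [b] ({f \<in> E. f \<inter> e = {}} - A) {e})
      = return_pmf (g e)" if e: "e \<in> A" for e
  proof -
    define H where "H = {f \<in> B. f \<inter> e = {}}"
    have H: "{f \<in> {f \<in> E. f \<inter> e = {}} - A. w f = b} = H"
      using ab by (auto simp: H_def A_def B_def)
    show ?thesis
    proof (cases "H = {}")
      case True
      then have "e \<in> K" using e by (auto simp: H_def K_def)
      then show ?thesis using True H single[OF e] by (simp add: g_def)
    next
      case False
      have "finite H" using finE by (simp add: H_def B_def)
      then have setH: "set_pmf (pmf_of_set H) = H" using False by simp
      have "e \<notin> K" using False by (auto simp: H_def K_def)
      have "map_pmf (matching_weight w) (rgma_run w [b] ({f \<in> E. f \<inter> e = {}} - A) {e})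
        = map_pmf (\<lambda>f. matching_weight w (insert f {e})) (pmf_of_set H)"
        unfolding rgma_run.simps H Let_def
        using False by (simp add: map_pmf_def bind_assoc_pmf bind_return_pmf)
      also have "\<dots> = map_pmf (\<lambda>f. a + b) (pmf_of_set H)"
        by (rule map_pmf_cong) (use setH pair[OF e] in \<open>auto simp: H_def\<close>)
      finally show ?thesis using \<open>e \<notin> K\<close> by (simp add: g_def)
    qed
  qed
  have "map_pmf (matching_weight w) (rgma E w)
      = pmf_of_set A \<bind> (\<lambda>e. map_pmf (matching_weight w)
          (rgma_run w [b] ({f \<in> E. f \<inter> e = {}} - A) {e}))"
    \<comment> \<open>Instantiating the recursion at weight \<open>a\<close> unfolds the first bush
      only and leaves the run on \<open>[b]\<close> in the form treated by
      \<open>second\<close>.\<close>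
    using A(2) unfolding rgma_def ew rgma_run.simps(2)[of w a] A_def[symmetric]
    by (simp add: map_bind_pmf del: rgma_run.simps)
  also have "\<dots> = pmf_of_set A \<bind> (\<lambda>e. return_pmf (g e))"
    by (rule bind_pmf_cong) (use A second in auto)
  also have "\<dots> = map_pmf g (pmf_of_set A)"
    by (simp add: map_pmf_def)
  finally have "map_pmf (matching_weight w) (rgma E w) = map_pmf g (pmf_of_set A)" .
  \<comment> \<open>Taking the mean of the identity under both laws turns equality of the weight
    distributions into equality of expectations.\<close>
  from arg_cong[OF this, of "\<lambda>p. measure_pmf.expectation p (\<lambda>x. x)"]
  have "measure_pmf.expectation (rgma E w) (matching_weight w)
      = measure_pmf.expectation (pmf_of_set A) g"
    by simp
  also have "\<dots> = (\<Sum>e\<in>A. g e) / card A"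
    using A by (simp add: integral_pmf_of_set)
  finally have expect: "measure_pmf.expectation (rgma E w) (matching_weight w)
      = (\<Sum>e\<in>A. g e) / card A" .

  have OPT: "OPT E w \<le> (if K = A then a else a + b)"
  proof -
    have "matching_weight w M \<le> (if K = A then a else a + b)" if "greedy_matching E w M" for M
    proof -
      have starA: "f \<inter> e \<noteq> {}" if "e \<in> E" "f \<in> E" "w e = a" "w f = a" for e f
        using that c by blast
      have "greedy_run w [a, b] E {} M"
        using that by (simp add: greedy_matching_def ew)
      \<comment> \<open>Since \<open>A\<close> is nonempty, the case without an edge of weight
        \<open>a\<close> is impossible.\<close>
      then obtain e where e: "e \<in> A" and run: "greedy_run w [b] {f \<in> E. f \<inter> e = {}} {e} M"
        by (rule greedy_run_star_cases) (use starA A(2) in \<open>auto simp: A_def\<close>)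
      from run show ?thesis
      proof (cases rule: greedy_run_star_cases)
        case (star e' f')
        then show ?case using d by blast
      next
        case no_edge
        then have "M = {e}" by (auto elim: greedy_run.cases)
        then show ?thesis using single[OF e] b0 by simp
      next
        case (edge f)
        then have "M = insert f {e}" by (auto elim: greedy_run.cases)
        moreover have "f \<in> B" "f \<inter> e = {}" using edge by (auto simp: B_def)
        \<comment> \<open>The edge \<open>f\<close> of the second bush is disjoint from
          \<open>e\<close>, so \<open>e\<close> is not in \<open>K\<close>.\<close>
        moreover have "K \<noteq> A" using calculation e by (auto simp: K_def)
        ultimately show ?thesis using pair[OF e] by simp
      qed
    qed
    then show ?thesis
      unfolding OPT_def using greedy_matchings_finite_nonempty[OF assms(1)]
      by (subst Max_le_iff) auto
  qed

  have cA: "0 < card A" using A by (simp add: card_gt_0_iff)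
  have "(\<Sum>e\<in>A. g e) = a * card A + b * (card A - card K)"
  proof -
    have "(\<Sum>e\<in>A. if e \<in> K then 0 else b) = (\<Sum>e\<in>A - K. b)"
      using A KA by (intro sum.mono_neutral_cong_right) auto
    then show ?thesis
      using A KA by (simp add: g_def sum.distrib card_Diff_subset finite_subset mult.commute)
  qed
  then have avg: "(\<Sum>e\<in>A. g e) / card A = a + b * (card A - card K) / card A"
    using cA by (simp add: field_simps)
  show ?thesis
  proof (cases "K = A")
    case True
    \<comment> \<open>Here the expectation equals \<open>a\<close>, which already bounds
      \<open>OPT\<close>.\<close>
    then show ?thesis using OPT avg expect ab b0 by simp
  next
    case False
    then have "card K \<le> 2" "card K < card A"
      using K KA A by (auto intro: psubset_card_mono)
    \<comment> \<open>At least one edge of \<open>A\<close> lies outside \<open>K\<close> and at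
      most two lie inside, so those outside make up at least a third; three edges with two in
      \<open>K\<close> is the extreme case.\<close>
    then have "card A \<le> 3 * (card A - card K)" by arith
    then have "b * card A \<le> b * (3 * (card A - card K))"
      using b0 by (simp flip: of_nat_le_iff)
    then have "b / 3 \<le> b * (card A - card K) / card A"
      using cA by (simp add: field_simps)
    \<comment> \<open>The inequality \<open>a + b / 3 \<ge> 2 / 3 * (a + b)\<close> rearranges to
      \<open>a \<ge> b\<close>.\<close>
    then show ?thesis using OPT False avg expect ab by simp
  qed
qed

end
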